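(* Let $\mathscr{A}$ be a Banach algebra with unit $I$, and let $P, Q \in \mathscr{A}$ be idempotents with $PQP = 0$. Then for any nonzero scalars $a$ and $b$, the element $aP+bQ$ is Drazin invertible, $\operatorname{ind}(aP+bQ) \le 1$, and $$(aP+bQ)^D=\frac{1}{a}P+\frac{1}{b}Q-\Big(\frac{1}{a}+\frac{1}{b}\Big)PQ-\Big(\frac{1}{a}+\frac{1}{b}\Big)QP+\Big(\frac{1}{a}+\frac{2}{b}\Big)QPQ.$$ Moreover, $\operatorname{ind}(aP+bQ)=0$ if and only if $P+Q+QPQ=I+PQ+QP$.
   Context: An element $P \in \mathscr{A}$ is an idempotent if $P^2=P$. An element $A \in \mathscr{A}$ is Drazin invertible if there is $B \in \mathscr{A}$ with $BAB=B$, $AB=BA$ and $A^{k+1}B=A^k$ for some nonnegative integer $k$ (with $A^0=I$). Such a $B$ is unique, is called the Drazin inverse of $A$ and is denoted $A^D$. The least such $k$ is the index of $A$, denoted $\operatorname{ind}(A)$. Scalars are elements of the base field of $\mathscr{A}$. *)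

theory Defs
  imports "HOL-Analysis.Analysis"
begin

text \<open>
  Unital Banach algebras over an arbitrary base field. By Gelfand--Mazur the class
  \<open>real_normed_field\<close> comprises, up to isometric isomorphism, exactly the real and the complex
  numbers, so \<open>'k\<close> ranges over the possible base fields. The unit comes from
  \<open>monoid_mult\<close> rather than \<open>real_normed_algebra_1\<close>, so that neither \<open>norm 1 = 1\<close>
  nor \<open>1 \<noteq> 0\<close> is imposed.
\<close>

locale banach_algebra_over = vector_space scale
  for scale :: "'k::real_normed_field \<Rightarrow> 'a::{real_normed_algebra, monoid_mult, banach} \<Rightarrow> 'a" +
  assumes scale_mult_left: "scale c x * y = scale c (x * y)"
    and scale_mult_right: "x * scale c y = scale c (x * y)"
    and norm_scale: "norm (scale c x) = norm c * norm x"
    and scale_of_real: "scale (of_real r) x = r *\<^sub>R x"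

lemma banach_algebra_over_scaleR:
  "banach_algebra_over (scaleR :: real \<Rightarrow> 'a::{real_normed_algebra, monoid_mult, banach} \<Rightarrow> 'a)"
  by unfold_locales (auto simp: algebra_simps)

lemma banach_algebra_over_complex: "banach_algebra_over ((*) :: complex \<Rightarrow> complex \<Rightarrow> complex)"
  by unfold_locales (auto simp: algebra_simps norm_mult scaleR_conv_of_real)

definition is_drazin_inverse :: "'a::monoid_mult \<Rightarrow> 'a \<Rightarrow> bool" where
  "is_drazin_inverse A B \<longleftrightarrow> B * A * B = B \<and> A * B = B * A \<and> (\<exists>k. A ^ (k + 1) * B = A ^ k)"

definition drazin_invertible :: "'a::monoid_mult \<Rightarrow> bool" where
  "drazin_invertible A \<longleftrightarrow> (\<exists>B. is_drazin_inverse A B)"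

text \<open>The two definitions below are meaningful only for Drazin invertible elements.\<close>

definition drazin_inverse :: "'a::monoid_mult \<Rightarrow> 'a" where
  "drazin_inverse A = (THE B. is_drazin_inverse A B)"

definition drazin_index :: "'a::monoid_mult \<Rightarrow> nat" where
  "drazin_index A = (LEAST k. A ^ (k + 1) * drazin_inverse A = A ^ k)"

lemma is_drazin_inverse_unique:
  fixes A B C :: "'a::monoid_mult"
  assumes "is_drazin_inverse A B" "is_drazin_inverse A C"
  shows "B = C"
proof -
  have mono: "A ^ (m + 1) * X = A ^ m" if "A ^ (k + 1) * X = A ^ k" "k \<le> m" for X :: 'a and k m
  proof -
    obtain d where d: "m = d + k" using \<open>k \<le> m\<close> by (metis le_iff_add add.commute)
    have "A ^ (m + 1) * X = A ^ d * (A ^ (k + 1) * X)"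
      unfolding d by (simp only: power_add mult.assoc add.assoc)
    then show ?thesis using that d by (simp add: power_add)
  qed
  from assms obtain k l where B: "B * A * B = B" "A * B = B * A" "A ^ (k + 1) * B = A ^ k"
    and C: "C * A * C = C" "A * C = C * A" "A ^ (l + 1) * C = A ^ l"
    unfolding is_drazin_inverse_def by blast
  define m where "m = max k l"
  have Bm: "A ^ (m + 1) * B = A ^ m" and Cm: "A ^ (m + 1) * C = A ^ m"
    using mono[OF B(3)] mono[OF C(3)] by (auto simp: m_def)
  have comB: "A ^ n * B = B * A ^ n" for n
    by (induction n) (simp_all add: mult.assoc B(2), metis B(2) mult.assoc)
  have powB: "B ^ (n + 1) * A ^ n = B" for n
  proof (induction n)
    case (Suc n)
    have "B ^ (Suc n + 1) * A ^ Suc n = B * (B ^ (n + 1) * A ^ n) * A"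
      by (simp add: mult.assoc power_Suc2 del: power_Suc)
        (metis mult.assoc power_Suc power_Suc2)
    also have "\<dots> = B" by (metis Suc.IH B(1,2) mult.assoc)
    finally show ?case .
  qed simp
  have powC: "A ^ n * C ^ (n + 1) = C" for n
  proof (induction n)
    case (Suc n)
    have "A ^ Suc n * C ^ (Suc n + 1) = A * (A ^ n * C ^ (n + 1)) * C"
      by (simp add: mult.assoc) (metis mult.assoc power_Suc power_Suc2)
    also have "\<dots> = C" by (metis Suc.IH C(1,2) mult.assoc)
    finally show ?case .
  qed simp
  have "B = B ^ (m + 1) * (A ^ (m + 1) * C)" using powB[of m] Cm by simp
  also have "\<dots> = (B ^ (m + 1) * A ^ m) * (A * C)" by (simp add: mult.assoc power_Suc2 del: power_Suc)
  finally have 1: "B = B * (A * C)" using powB[of m] by simp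
  have "C = (A ^ (m + 1) * B) * C ^ (m + 1)" using powC[of m] Bm by simp
  also have "\<dots> = B * A * (A ^ m * C ^ (m + 1))" by (simp only: comB) (simp add: mult.assoc)
  finally have "C = B * (A * C)" using powC[of m] by (simp add: mult.assoc)
  with 1 show ?thesis by simp
qed

end

theory Submission
  imports Defs
begin

text \<open>
  Put \<open>A = a P + b Q\<close>, and let \<open>B\<close> be the element on the right of the claimed formula. Because
  \<open>P Q P = 0\<close>, the words in \<open>P\<close> and \<open>Q\<close> collapse to \<open>P\<close>, \<open>Q\<close>, \<open>P Q\<close>, \<open>Q P\<close>, \<open>Q P Q\<close>, and
  the coefficients of \<open>B\<close> are the ones for which
  \[ a P B = P - P Q, \qquad b Q B = Q - Q P + Q P Q. \]
  The two right-hand sides \<open>U = P (1 - Q)\<close> and \<open>V = Q (1 - P + P Q)\<close> are orthogonal idempotents,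
  so \<open>E = A B = U + V\<close> is an idempotent. It is unchanged by reversing words, as are \<open>A\<close>
  and \<open>B\<close>, so \<open>B A = E\<close> too. Moreover \<open>U A = a P\<close> and \<open>V A = b Q\<close>, so that \<open>E A = A\<close>; similarly
  \<open>E B = B\<close>. Thus \<open>B\<close> is a group inverse of \<open>A\<close>, that is, a Drazin inverse for the exponent
  \<open>k = 1\<close>, and the index drops to 0 exactly when \<open>E = 1\<close>. That last equation, with its terms moved
  to make all signs positive, is the stated criterion; as
  \<open>1 - E = (1 - Q) (1 - P) (1 - Q)\<close>, it says that the complementary idempotents satisfy
  \<open>(1 - Q) (1 - P) (1 - Q) = 0\<close>.
\<close>

text \<open>
  A group inverse is a Drazin inverse for \<open>k = 1\<close>, so uniqueness of the Drazin inverse identifies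
  the definite description with it. For exponent 0 the defining equation of the index
  reads \<open>A * B = 1\<close>.
\<close>

lemma group_inverse_drazin:
  fixes A B :: "'a::monoid_mult"
  assumes "B * A * B = B" and "A * B = B * A" and "A * A * B = A"
  shows "drazin_invertible A" and "drazin_inverse A = B"
    and "drazin_index A \<le> 1" and "drazin_index A = 0 \<longleftrightarrow> A * B = 1"
proof -
  have "A ^ (1 + 1) * B = A ^ 1"
    using assms(3) by simp
  then have B: "is_drazin_inverse A B"
    using assms(1,2) unfolding is_drazin_inverse_def by blast
  then show "drazin_invertible A"
    unfolding drazin_invertible_def by blast
  show inv: "drazin_inverse A = B"
    unfolding drazin_inverse_def using B is_drazin_inverse_unique by blast
  have one: "A ^ (1 + 1) * drazin_inverse A = A ^ 1"
    using assms(3) inv by simp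
  then show "drazin_index A \<le> 1"
    unfolding drazin_index_def by (rule Least_le)
  show "drazin_index A = 0 \<longleftrightarrow> A * B = 1"
  proof
    assume "drazin_index A = 0"
    moreover have "A ^ (drazin_index A + 1) * drazin_inverse A = A ^ drazin_index A"
      unfolding drazin_index_def using one by (rule LeastI)
    ultimately show "A * B = 1"
      using inv by simp
  next
    assume "A * B = 1"
    then have "A ^ (0 + 1) * drazin_inverse A = A ^ 0"
      using inv by simp
    then have "drazin_index A \<le> 0"
      unfolding drazin_index_def by (rule Least_le)
    then show "drazin_index A = 0"
      by simp
  qed
qed

context banach_algebra_over
begin

text \<open>
  The one-sided products with \<open>P\<close> and \<open>Q\<close> are where the coefficients cancel: each of them leaves
  a single scalar, \<open>1 / a\<close> or \<open>1 / b\<close>, which the factor \<open>a\<close> or \<open>b\<close> in \<open>a P + b Q\<close> then removes.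
\<close>

lemma idempotent_combination_group_inverse:
  fixes P Q :: 'a and a b :: 'k
  assumes P: "P\<^sup>2 = P" and Q: "Q\<^sup>2 = Q" and PQP: "P * Q * P = 0"
    and a: "a \<noteq> 0" and b: "b \<noteq> 0"
  defines "A \<equiv> scale a P + scale b Q"
    and "B \<equiv> scale (1 / a) P + scale (1 / b) Q - scale (1 / a + 1 / b) (P * Q)
          - scale (1 / a + 1 / b) (Q * P) + scale (1 / a + 2 / b) (Q * P * Q)"
    and "E \<equiv> P + Q - P * Q - Q * P + Q * P * Q"
  shows "A * B = E" and "B * A = E" and "E * A = A" and "E * B = B"
proof -
  have PP: "P * P = P" "P * (P * x) = P * x" for x
    using P by (simp_all add: power2_eq_square flip: mult.assoc)
  have QQ: "Q * Q = Q" "Q * (Q * x) = Q * x" for x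
    using Q by (simp_all add: power2_eq_square flip: mult.assoc)
  have PQP0: "P * (Q * P) = 0" "P * (Q * (P * x)) = 0" for x
    using PQP by (simp_all flip: mult.assoc)
  note words = PP QQ PQP0 mult.assoc
  note linear = ring_distribs scale_mult_left scale_mult_right
    scale_right_distrib scale_right_diff_distrib scale_left_distrib
  have two: "scale (2 / b) x = scale (1 / b) x + scale (1 / b) x" for x
    by (simp flip: scale_left_distrib)
  have PB: "P * B = scale (1 / a) (P - P * Q)"
    unfolding B_def by (simp add: words linear)
  have QB: "Q * B = scale (1 / b) (Q - Q * P + Q * P * Q)"
    unfolding B_def by (simp add: words linear two)
  have BP: "B * P = scale (1 / a) (P - Q * P)"
    unfolding B_def by (simp add: words linear)
  have BQ: "B * Q = scale (1 / b) (Q - P * Q + Q * P * Q)"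
    unfolding B_def by (simp add: words linear two)
  show "A * B = E"
    unfolding A_def E_def using a b
    by (simp add: distrib_right scale_mult_left PB QB)
  show "B * A = E"
    unfolding A_def E_def using a b
    by (simp add: distrib_left scale_mult_right BP BQ)
  show "E * A = A"
    unfolding A_def E_def by (simp add: words linear)
  have "E * B = P * B + Q * B - P * (Q * B) - Q * (P * B) + Q * (P * (Q * B))"
    unfolding E_def by (simp add: ring_distribs mult.assoc)
  also have "\<dots> = B"
    unfolding PB QB by (simp add: B_def words linear two)
  finally show "E * B = B" .
qed

end

theorem theorem2p1:
  fixes scale :: "'k::real_normed_field \<Rightarrow> 'a::{real_normed_algebra, monoid_mult, banach} \<Rightarrow> 'a"
    and P Q :: 'a and a b :: 'k
  assumes "banach_algebra_over scale"
    and "P\<^sup>2 = P" and "Q\<^sup>2 = Q" and "P * Q * P = 0"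
    and "a \<noteq> 0" and "b \<noteq> 0"
  shows "drazin_invertible (scale a P + scale b Q)
    \<and> drazin_index (scale a P + scale b Q) \<le> 1
    \<and> drazin_inverse (scale a P + scale b Q) =
        scale (1 / a) P + scale (1 / b) Q - scale (1 / a + 1 / b) (P * Q)
          - scale (1 / a + 1 / b) (Q * P) + scale (1 / a + 2 / b) (Q * P * Q)
    \<and> (drazin_index (scale a P + scale b Q) = 0 \<longleftrightarrow> P + Q + Q * P * Q = 1 + P * Q + Q * P)"
proof -
  define A where "A = scale a P + scale b Q"
  define B where "B = scale (1 / a) P + scale (1 / b) Q - scale (1 / a + 1 / b) (P * Q)
    - scale (1 / a + 1 / b) (Q * P) + scale (1 / a + 2 / b) (Q * P * Q)"
  define E where "E = P + Q - P * Q - Q * P + Q * P * Q"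
  note gi = banach_algebra_over.idempotent_combination_group_inverse
    [OF assms, folded A_def B_def E_def]
  have "B * A * B = B"
    using gi(2,4) by simp
  moreover have "A * B = B * A"
    using gi(1,2) by simp
  moreover have "A * A * B = A"
    using gi(1-3) by (metis mult.assoc)
  ultimately have drazin: "drazin_invertible A" "drazin_inverse A = B" "drazin_index A \<le> 1"
      "drazin_index A = 0 \<longleftrightarrow> A * B = 1"
    by (rule group_inverse_drazin)+
  have "E = 1 \<longleftrightarrow> P + Q + Q * P * Q = 1 + P * Q + Q * P"
    unfolding E_def by (auto simp: algebra_simps)
  then show ?thesis
    using drazin gi(1) unfolding A_def[symmetric] B_def[symmetric] by simp
qed

end
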